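(* For every $G\in\mathbb{Np}^\infty$: $G\succcurlyeq 0$ if and only if $o(G)\in\{\mathscr L,\mathscr P\}$, where $0=\{\overline\infty\mid\infty\}$.
   Context: Affine normal play forms $\mathbb{Np}^\infty$ are defined recursively: two atomic forms $\infty$ and $\overline{\infty}$ with no options; every other form is $G=\{G^{\mathcal L}\mid G^{\mathcal R}\}$ with finite nonempty sets of previously constructed forms as Left and Right options. Disjunctive sum: $\infty+X=X+\infty=\infty$ for $X\neq\overline{\infty}$; $\overline{\infty}+X=X+\overline{\infty}=\overline{\infty}$ for $X\ne\infty$; $\infty+\overline{\infty}$ undefined; otherwise $G+H=\{G^L+H,G+H^L\mid G^R+H,G+H^R\}$. Outcomes: Left wins $\infty$ and Right wins $\overline{\infty}$ whoever moves; otherwise play alternates, Left moving first wins iff some Left option is won by Left moving second, Left moving second wins iff every Right option is won by Left moving first, symmetrically for Right. $o(G)$ is $\mathscr L$ (Left wins moving first and second), $\mathscr R$ (Right wins either way), $\mathscr N$ (first player wins), $\mathscr P$ (second player wins), partially ordered by $\mathscr L>\mathscr N>\mathscr R$, $\mathscr L>\mathscr P>\mathscr R$, with $\mathscr N,\mathscr P$ incomparable. $G\succcurlyeq H$ means $o(G+X)\geqslant o(H+X)$ for every $X\in\mathbb{Np}^\infty\setminus\{\infty,\overline\infty\}$. *)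

theory Defs
  imports "HOL-Library.FSet"
begin

text \<open>
  The type below also contains forms with empty option sets; the affine normal play forms are
  the elements of the set \<open>Np\<close> defined afterwards.
\<close>

datatype form =
    Inf_form  ("\<infinity>")
  | NInf_form ("\<infinity>\<^sup>-")
  | Form "form fset" "form fset"

inductive_set Np :: "form set" where
  Inf: "\<infinity> \<in> Np"
| NInf: "\<infinity>\<^sup>- \<in> Np"
| Form: "L \<noteq> {||} \<Longrightarrow> R \<noteq> {||} \<Longrightarrow> (\<And>G. G |\<in>| L \<Longrightarrow> G \<in> Np) \<Longrightarrow> (\<And>G. G |\<in>| R \<Longrightarrow> G \<in> Np)
    \<Longrightarrow> Form L R \<in> Np"

definition zero_form :: form ("\<zero>") where
  "\<zero> = Form {|\<infinity>\<^sup>-|} {|\<infinity>|}"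

lemma size_less_if_option [termination_simp]:
  assumes "G |\<in>| A"
  shows "size G < Suc (size_fset size A + n)" "size G < Suc (n + size_fset size A)"
    "size G < Suc ((\<Sum>x\<in>fset A. Suc (size x)) + n)"
    "size G < Suc (n + (\<Sum>x\<in>fset A. Suc (size x)))"
proof -
  have "Suc (size G) \<le> (\<Sum>x\<in>fset A. Suc (size x))"
    using member_le_sum[of G "fset A" "\<lambda>x. Suc (size x)"] assms by simp
  then show "size G < Suc (size_fset size A + n)" "size G < Suc (n + size_fset size A)"
    "size G < Suc ((\<Sum>x\<in>fset A. Suc (size x)) + n)"
    "size G < Suc (n + (\<Sum>x\<in>fset A. Suc (size x)))"
    by (simp_all add: size_fset_simps)
qed

declare fimage_cong [fundef_cong]

text \<open>The undefined sum of the two atoms is rendered by the unspecified value \<open>undefined\<close>.\<close>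

function game_sum :: "form \<Rightarrow> form \<Rightarrow> form"  (infixl "\<oplus>" 65) where
  "\<infinity> \<oplus> \<infinity>\<^sup>- = undefined"
| "\<infinity>\<^sup>- \<oplus> \<infinity> = undefined"
| "X \<noteq> \<infinity>\<^sup>- \<Longrightarrow> \<infinity> \<oplus> X = \<infinity>"
| "X \<noteq> \<infinity>\<^sup>- \<Longrightarrow> X \<oplus> \<infinity> = \<infinity>"
| "X \<noteq> \<infinity> \<Longrightarrow> \<infinity>\<^sup>- \<oplus> X = \<infinity>\<^sup>-"
| "X \<noteq> \<infinity> \<Longrightarrow> X \<oplus> \<infinity>\<^sup>- = \<infinity>\<^sup>-"
| "Form GL GR \<oplus> Form HL HR =
     Form ((\<lambda>G. G \<oplus> Form HL HR) |`| GL |\<union>| (\<lambda>H. Form GL GR \<oplus> H) |`| HL)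
          ((\<lambda>G. G \<oplus> Form HL HR) |`| GR |\<union>| (\<lambda>H. Form GL GR \<oplus> H) |`| HR)"
  apply (metis form.exhaust surj_pair)
  by simp_all
termination
  by (relation "measure (\<lambda>(G, H). size G + size H)") (auto simp: termination_simp)

fun left_wins_first :: "form \<Rightarrow> bool" and left_wins_second :: "form \<Rightarrow> bool" where
  "left_wins_first \<infinity> = True"
| "left_wins_first \<infinity>\<^sup>- = False"
| "left_wins_first (Form L R) = (\<exists>G |\<in>| L. left_wins_second G)"
| "left_wins_second \<infinity> = True"
| "left_wins_second \<infinity>\<^sup>- = False"
| "left_wins_second (Form L R) = (\<forall>G |\<in>| R. left_wins_first G)"

fun right_wins_first :: "form \<Rightarrow> bool" and right_wins_second :: "form \<Rightarrow> bool" where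
  "right_wins_first \<infinity> = False"
| "right_wins_first \<infinity>\<^sup>- = True"
| "right_wins_first (Form L R) = (\<exists>G |\<in>| R. right_wins_second G)"
| "right_wins_second \<infinity> = False"
| "right_wins_second \<infinity>\<^sup>- = True"
| "right_wins_second (Form L R) = (\<forall>G |\<in>| L. right_wins_first G)"

lemma right_wins_iff:
  "right_wins_second G \<longleftrightarrow> \<not> left_wins_first G" "right_wins_first G \<longleftrightarrow> \<not> left_wins_second G"
  by (induction G) auto

datatype outcome = \<L> | \<N> | \<P> | \<R>

instantiation outcome :: order
begin

definition less_eq_outcome :: "outcome \<Rightarrow> outcome \<Rightarrow> bool" where
  "a \<le> b \<longleftrightarrow> a = b \<or> a = \<R> \<or> b = \<L>"

definition less_outcome :: "outcome \<Rightarrow> outcome \<Rightarrow> bool" where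
  "a < b \<longleftrightarrow> a \<le> b \<and> a \<noteq> (b :: outcome)"

instance
  by standard (auto simp: less_eq_outcome_def less_outcome_def)

end

definition outcome :: "form \<Rightarrow> outcome" where
  "outcome G =
    (if left_wins_first G \<and> left_wins_second G then \<L>
     else if right_wins_first G \<and> right_wins_second G then \<R>
     else if left_wins_first G \<and> right_wins_first G then \<N>
     else \<P>)"

lemma outcome_iff:
  "outcome G = \<L> \<longleftrightarrow> left_wins_first G \<and> left_wins_second G"
  "outcome G = \<R> \<longleftrightarrow> right_wins_first G \<and> right_wins_second G"
  "outcome G = \<N> \<longleftrightarrow> left_wins_first G \<and> right_wins_first G"
  "outcome G = \<P> \<longleftrightarrow> left_wins_second G \<and> right_wins_second G"
  by (auto simp: outcome_def right_wins_iff)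

definition game_ge :: "form \<Rightarrow> form \<Rightarrow> bool"  (infix "\<succeq>" 50) where
  "G \<succeq> H \<longleftrightarrow> (\<forall>X \<in> Np - {\<infinity>, \<infinity>\<^sup>-}. outcome (G \<oplus> X) \<ge> outcome (H \<oplus> X))"

end

theory Submission imports Defs begin

text \<open>
  Adding \<open>\<zero>\<close> does not change the outcome, as moving in \<open>\<zero>\<close> loses at once. If Left wins \<open>G\<close>
  moving second, then in \<open>G \<oplus> X\<close> she follows her strategy on \<open>X\<close> and answers each move of Right
  in \<open>G\<close> locally, so \<open>G \<oplus> X\<close> is at least as good for her as \<open>X\<close>. Conversely, testing
  \<open>G \<succeq> \<zero>\<close> against \<open>X = \<zero>\<close>, which has outcome \<open>\<P>\<close>, gives the outcome of \<open>G\<close>.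
\<close>

lemma game_sum_commute: "G \<oplus> H = H \<oplus> G"
proof (induction G H rule: game_sum.induct)
  case (7 GL GR HL HR)
  have "(\<lambda>G. G \<oplus> Form HL HR) |`| GL = (\<lambda>G. Form HL HR \<oplus> G) |`| GL"
    "(\<lambda>H. Form GL GR \<oplus> H) |`| HL = (\<lambda>H. H \<oplus> Form GL GR) |`| HL"
    "(\<lambda>G. G \<oplus> Form HL HR) |`| GR = (\<lambda>G. Form HL HR \<oplus> G) |`| GR"
    "(\<lambda>H. Form GL GR \<oplus> H) |`| HR = (\<lambda>H. H \<oplus> Form GL GR) |`| HR"
    using 7 by (auto intro!: fimage_cong)
  then show ?case by (simp add: funion_commute)
qed simp_all

lemma left_wins_sum_zero:
  "left_wins_first (G \<oplus> \<zero>) \<longleftrightarrow> left_wins_first G"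
  "left_wins_second (G \<oplus> \<zero>) \<longleftrightarrow> left_wins_second G"
  by (induction G) (auto simp: zero_form_def)

lemma outcome_sum_zero: "outcome (G \<oplus> \<zero>) = outcome G"
  by (simp add: outcome_def right_wins_iff left_wins_sum_zero)

text \<open>Joint induction: a Right move in one summand leaves Left to move there, the other still
  won moving second, as in the last two claims; her winning reply leads back to the first.\<close>

lemma left_wins_sum:
  "left_wins_second G \<Longrightarrow> left_wins_second X \<Longrightarrow> left_wins_second (G \<oplus> X)"
  "left_wins_second G \<Longrightarrow> left_wins_first X \<Longrightarrow> left_wins_first (G \<oplus> X)"
  "left_wins_first G \<Longrightarrow> left_wins_second X \<Longrightarrow> left_wins_first (G \<oplus> X)"
proof (induction G X rule: game_sum.induct)
  case (7 GL GR HL HR)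
  {
    case 1
    then show ?case using 7 by auto
  next
    case 2
    then obtain X where "X |\<in>| HL" "left_wins_second X"
      by auto
    with 7(4)[of X] 2(1) show ?case by auto
  next
    case 3
    then obtain Y where "Y |\<in>| GL" "left_wins_second Y"
      by auto
    with 7(1)[of Y] 3(2) show ?case by auto
  }
qed simp_all

text \<open>The outcome order is the product order on two truth values: Left wins moving first, Left
  wins moving second.\<close>

lemma outcome_le_iff:
  "outcome G \<le> outcome H \<longleftrightarrow>
    (left_wins_first G \<longrightarrow> left_wins_first H) \<and> (left_wins_second G \<longrightarrow> left_wins_second H)"
  by (auto simp: less_eq_outcome_def outcome_def right_wins_iff)

lemma outcome_in_L_P_iff: "outcome G \<in> {\<L>, \<P>} \<longleftrightarrow> left_wins_second G"
  by (auto simp: outcome_iff right_wins_iff)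

theorem theorem2p8:
  fixes G :: form
  assumes "G \<in> Np"
  shows "G \<succeq> \<zero> \<longleftrightarrow> outcome G \<in> {\<L>, \<P>}"
proof
  assume "G \<succeq> \<zero>"
  moreover have "\<zero> \<in> Np - {\<infinity>, \<infinity>\<^sup>-}"
    by (auto simp: zero_form_def intro: Np.intros)
  ultimately have "outcome \<zero> \<le> outcome G"
    unfolding game_ge_def by (metis outcome_sum_zero)
  moreover have "left_wins_second \<zero>"
    by (simp add: zero_form_def)
  ultimately show "outcome G \<in> {\<L>, \<P>}"
    by (simp only: outcome_le_iff outcome_in_L_P_iff)
next
  assume "outcome G \<in> {\<L>, \<P>}"
  then have "left_wins_second G"
    by (simp only: outcome_in_L_P_iff)
  \<comment> \<open>Commuting puts \<open>\<zero>\<close> on the right, where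
    \<open>left_wins_sum_zero\<close> removes it.\<close>
  then show "G \<succeq> \<zero>"
    by (simp add: game_ge_def outcome_le_iff game_sum_commute[of \<zero>] left_wins_sum_zero
        left_wins_sum)
qed

end
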